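(* Let $T>0$ and $X,\tilde X\in C^2([0,T]^2;\mathbb{R}^d)$ with full 2D signatures $\mathbf S(X)$, $\mathbf S(\tilde X)$. Let $w=(w_1,\dots,w_n)$ be a word in $\{1,\dots,d\}$ and $\tau$ a permutation of $\{1,\dots,n\}$. Then for all $\mathbf s=(s_1,s_2),\mathbf t=(t_1,t_2)\in[0,T]^2$ with $s_1\le t_1$, $s_2\le t_2$, $$\big|\langle\mathbf S_{\mathbf s\mathbf t}(X)-\mathbf S_{\mathbf s\mathbf t}(\tilde X),(w,\tau)\rangle\big|\le\frac{T^{2n}}{(n!)^2}\sum_{k=1}^n\Big(\prod_{i=1}^{k-1}\|X^{w_i}\|_{C^2}\prod_{j=k+1}^n\|\tilde X^{w_j}\|_{C^2}\Big)\|X^{w_k}-\tilde X^{w_k}\|_{C^2}.$$ In particular, the mapping $X\mapsto\mathbf S_{\mathbf s\mathbf t}(X)$ is locally Lipschitz, in the sense that each coordinate $X\mapsto\langle\mathbf S_{\mathbf s\mathbf t}(X),(w,\tau)\rangle$ is locally Lipschitz on $C^2([0,T]^2;\mathbb R^d)$.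
   Context: $\|\cdot\|_{C^2}$ is the usual norm on $C^2([0,T]^2)$ (sum of the sup norms over $[0,T]^2$ of all partial derivatives of order at most $2$). Full 2D signature: with $\partial_{12}X=\frac{\partial^2X}{\partial r_1\partial r_2}$, $$\langle \mathbf S_{\mathbf s\mathbf t}(X),(w,\tau)\rangle=\int_{\Delta^n_{[\mathbf s,\mathbf t]}}\prod_{i=1}^n\partial_{12}X^{w_i}(r_1^i,r_2^{\tau(i)})\,d\mathbf r^1\cdots d\mathbf r^n,$$ where $\mathbf r^i=(r_1^i,r_2^i)$ and $\Delta^n_{[\mathbf s,\mathbf t]}=\{(\mathbf r^1,\dots,\mathbf r^n): s_1\le r_1^1\le\dots\le r_1^n\le t_1,\ s_2\le r_2^1\le\dots\le r_2^n\le t_2\}$ (value $1$ for the empty word). *)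

theory Defs
  imports "HOL-Analysis.Analysis" "HOL-Combinatorics.Permutations"
begin

definition square :: "real \<Rightarrow> (real \<times> real) set" where
  "square T = {0..T} \<times> {0..T}"

text \<open>
  Partial derivatives are taken within the square, i.e. they are one-sided on its boundary.
  Hence only the values of a function on the square matter, and a total function
  represents its restriction to the square.
\<close>

definition pd1 :: "real \<Rightarrow> (real \<times> real \<Rightarrow> 'b::real_normed_vector) \<Rightarrow> real \<times> real \<Rightarrow> 'b" where
  "pd1 T f = (\<lambda>(x, y). vector_derivative (\<lambda>u. f (u, y)) (at x within {0..T}))"

definition pd2 :: "real \<Rightarrow> (real \<times> real \<Rightarrow> 'b::real_normed_vector) \<Rightarrow> real \<times> real \<Rightarrow> 'b" where
  "pd2 T f = (\<lambda>(x, y). vector_derivative (\<lambda>v. f (x, v)) (at y within {0..T}))"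

definition has_partials :: "real \<Rightarrow> (real \<times> real \<Rightarrow> 'b::real_normed_vector) \<Rightarrow> bool" where
  "has_partials T f \<longleftrightarrow> (\<forall>x\<in>{0..T}. \<forall>y\<in>{0..T}.
     (\<lambda>u. f (u, y)) differentiable (at x within {0..T}) \<and>
     (\<lambda>v. f (x, v)) differentiable (at y within {0..T}))"

primrec Ck_square :: "nat \<Rightarrow> real \<Rightarrow> (real \<times> real \<Rightarrow> 'b::real_normed_vector) \<Rightarrow> bool" where
  "Ck_square 0 T f \<longleftrightarrow> continuous_on (square T) f"
| "Ck_square (Suc k) T f \<longleftrightarrow> continuous_on (square T) f \<and> has_partials T f \<and>
     Ck_square k T (pd1 T f) \<and> Ck_square k T (pd2 T f)"

abbreviation C2 :: "real \<Rightarrow> (real \<times> real \<Rightarrow> 'b::real_normed_vector) \<Rightarrow> bool" where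
  "C2 T f \<equiv> Ck_square 2 T f"

definition sup_norm :: "real \<Rightarrow> (real \<times> real \<Rightarrow> 'b::real_normed_vector) \<Rightarrow> real" where
  "sup_norm T f = (SUP p\<in>square T. norm (f p))"

text \<open>
  One summand for each multi-index of order at most two, so that the mixed derivative
  is counted once.
\<close>

definition C2_norm :: "real \<Rightarrow> (real \<times> real \<Rightarrow> 'b::real_normed_vector) \<Rightarrow> real" where
  "C2_norm T f =
     sup_norm T f + sup_norm T (pd1 T f) + sup_norm T (pd2 T f) +
     sup_norm T (pd1 T (pd1 T f)) + sup_norm T (pd1 T (pd2 T f)) + sup_norm T (pd2 T (pd2 T f))"

text \<open>
  A point of the \<open>n\<close>-fold product of the plane is a function on the index set \<open>{..<n}\<close>
  (indices start at 0). For \<open>n = 0\<close> the product is a one-point space of mass 1, so the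
  signature of the empty word is 1.
\<close>

definition simplex2 :: "nat \<Rightarrow> real \<times> real \<Rightarrow> real \<times> real \<Rightarrow> (nat \<Rightarrow> real \<times> real) set" where
  "simplex2 n s t = {r \<in> {..<n} \<rightarrow>\<^sub>E UNIV.
     sorted (fst s # map (\<lambda>i. fst (r i)) [0..<n] @ [fst t]) \<and>
     sorted (snd s # map (\<lambda>i. snd (r i)) [0..<n] @ [snd t])}"

text \<open>
  The coordinate of the full signature over the rectangle \<open>[s, t]\<close> at a word \<open>w\<close> and a
  permutation \<open>\<tau>\<close> of its positions \<open>{..<length w}\<close>.
\<close>

definition full_signature ::
  "real \<Rightarrow> real \<times> real \<Rightarrow> real \<times> real \<Rightarrow> (real \<times> real \<Rightarrow> real^'d) \<Rightarrow> 'd list \<times> (nat \<Rightarrow> nat) \<Rightarrow> real"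
  where
  "full_signature T s t X = (\<lambda>(w, \<tau>).
     LINT r:simplex2 (length w) s t|PiM {..<length w} (\<lambda>_. lborel).
       (\<Prod>i<length w. pd1 T (pd2 T (\<lambda>p. X p $ (w ! i))) (fst (r i), snd (r (\<tau> i)))))"

definition C2_locally_lipschitz ::
  "real \<Rightarrow> ((real \<times> real \<Rightarrow> 'b::real_normed_vector) \<Rightarrow> real) \<Rightarrow> bool" where
  "C2_locally_lipschitz T F \<longleftrightarrow> (\<forall>X0. C2 T X0 \<longrightarrow> (\<exists>\<epsilon>>0. \<exists>L\<ge>0. \<forall>X Y.
     C2 T X \<longrightarrow> C2 T Y \<longrightarrow> C2_norm T (\<lambda>p. X p - X0 p) < \<epsilon> \<longrightarrow> C2_norm T (\<lambda>p. Y p - X0 p) < \<epsilon> \<longrightarrow>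
     \<bar>F X - F Y\<bar> \<le> L * C2_norm T (\<lambda>p. X p - Y p)))"

end

theory Submission
  imports Defs
begin

text \<open>
  Telescoping writes the difference of the two integrands as a sum over \<open>k\<close> in which the first
  \<open>k\<close> factors come from \<open>X\<close>, the last ones from \<open>X'\<close>, and the factor in between is the mixed
  derivative of the difference; each factor is bounded on the square by a \<open>C\<^sup>2\<close> norm.
  The domain of integration is, up to reordering coordinates, a product of two simplices, so
  integrating out the last point shows by induction that its volume is
  \<open>((t\<^sub>1 - s\<^sub>1) (t\<^sub>2 - s\<^sub>2))\<^sup>n / (n!)\<^sup>2\<close>. On a \<open>C\<^sup>2\<close> ball the bound is linear in the \<open>C\<^sup>2\<close> norm
  of the difference.
\<close>

subsection \<open>Partial derivatives and the norm on the square\<close>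

lemma has_partials_has_vector_derivative:
  assumes "has_partials T f" and "(x, y) \<in> square T"
  shows "((\<lambda>u. f (u, y)) has_vector_derivative pd1 T f (x, y)) (at x within {0..T})"
    and "((\<lambda>v. f (x, v)) has_vector_derivative pd2 T f (x, y)) (at y within {0..T})"
  using assms by (auto simp: has_partials_def pd1_def pd2_def square_def vector_derivative_works)

text \<open>No point of a nondegenerate interval is isolated, so a derivative within it is unique,
  including the one-sided ones at the endpoints.\<close>

lemma at_within_Icc_neq_bot:
  fixes x :: real
  assumes "a < b" "x \<in> {a..b}"
  shows "at x within {a..b} \<noteq> bot"
  using assms by (simp add: trivial_limit_within islimpt_Icc)

lemma
  fixes f :: "real \<times> real \<Rightarrow> 'b::real_normed_vector"
  assumes "T > 0"
    and "\<And>x y. (x, y) \<in> square T \<Longrightarrow>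
      ((\<lambda>u. f (u, y)) has_vector_derivative d1 (x, y)) (at x within {0..T})"
    and "\<And>x y. (x, y) \<in> square T \<Longrightarrow>
      ((\<lambda>v. f (x, v)) has_vector_derivative d2 (x, y)) (at y within {0..T})"
  shows has_partialsI: "has_partials T f"
    and pd1_eqI: "\<And>p. p \<in> square T \<Longrightarrow> pd1 T f p = d1 p"
    and pd2_eqI: "\<And>p. p \<in> square T \<Longrightarrow> pd2 T f p = d2 p"
proof -
  show "has_partials T f"
    using assms(2,3) unfolding has_partials_def square_def
    by (blast intro: differentiableI_vector)
  show "pd1 T f p = d1 p" "pd2 T f p = d2 p" if "p \<in> square T" for p
    using that assms
    by (auto simp: pd1_def pd2_def square_def at_within_Icc_neq_bot
        intro!: vector_derivative_within)
qed

text \<open>Difference quotients within the square see only values there. This permits rewriting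
  under an outer \<open>pd1\<close> or \<open>pd2\<close> with an identity known on the square
  alone.\<close>

lemma
  fixes f g :: "real \<times> real \<Rightarrow> 'b::real_normed_vector"
  assumes "T > 0" and "has_partials T f" and "\<And>p. p \<in> square T \<Longrightarrow> g p = f p"
  shows has_partials_cong: "has_partials T g"
    and pd1_cong: "\<And>p. p \<in> square T \<Longrightarrow> pd1 T g p = pd1 T f p"
    and pd2_cong: "\<And>p. p \<in> square T \<Longrightarrow> pd2 T g p = pd2 T f p"
proof -
  have d: "((\<lambda>u. g (u, y)) has_vector_derivative pd1 T f (x, y)) (at x within {0..T})"
      "((\<lambda>v. g (x, v)) has_vector_derivative pd2 T f (x, y)) (at y within {0..T})"
    if "(x, y) \<in> square T" for x y
    using that assms(3)
    by (auto simp: square_def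
        intro!: has_vector_derivative_transform[OF _ _ has_partials_has_vector_derivative(1)[OF assms(2)]]
          has_vector_derivative_transform[OF _ _ has_partials_has_vector_derivative(2)[OF assms(2)]])
  show "has_partials T g"
    by (rule has_partialsI[OF assms(1) d])
  show "pd1 T g p = pd1 T f p" "pd2 T g p = pd2 T f p" if "p \<in> square T" for p
    using pd1_eqI[OF assms(1) d that] pd2_eqI[OF assms(1) d that] by auto
qed

text \<open>A bounded linear map commutes with limits of difference quotients. It is applied to
  coordinate projections.\<close>

lemma
  fixes f :: "real \<times> real \<Rightarrow> 'b::real_normed_vector"
    and h :: "'b \<Rightarrow> 'c::real_normed_vector"
  assumes "T > 0" and "has_partials T f" and "bounded_linear h"
  shows has_partials_bounded_linear: "has_partials T (\<lambda>p. h (f p))"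
    and pd1_bounded_linear: "\<And>p. p \<in> square T \<Longrightarrow> pd1 T (\<lambda>p. h (f p)) p = h (pd1 T f p)"
    and pd2_bounded_linear: "\<And>p. p \<in> square T \<Longrightarrow> pd2 T (\<lambda>p. h (f p)) p = h (pd2 T f p)"
proof -
  note d = bounded_linear.has_vector_derivative[OF assms(3) has_partials_has_vector_derivative(1)[OF assms(2)]]
    bounded_linear.has_vector_derivative[OF assms(3) has_partials_has_vector_derivative(2)[OF assms(2)]]
  show "has_partials T (\<lambda>p. h (f p))"
    by (rule has_partialsI[OF assms(1), of _ "\<lambda>p. h (pd1 T f p)" "\<lambda>p. h (pd2 T f p)"]) (intro d; assumption)+
  show "pd1 T (\<lambda>p. h (f p)) p = h (pd1 T f p)" "pd2 T (\<lambda>p. h (f p)) p = h (pd2 T f p)"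
    if "p \<in> square T" for p
    by (rule pd1_eqI[OF assms(1), of _ "\<lambda>p. h (pd1 T f p)" "\<lambda>p. h (pd2 T f p)"]
        pd2_eqI[OF assms(1), of _ "\<lambda>p. h (pd1 T f p)" "\<lambda>p. h (pd2 T f p)"];
        (rule that | (rule d, assumption)))+
qed

lemma
  fixes f g :: "real \<times> real \<Rightarrow> 'b::real_normed_vector"
  assumes "T > 0" and "has_partials T f" and "has_partials T g"
  shows has_partials_diff: "has_partials T (\<lambda>p. f p - g p)"
    and pd1_diff: "\<And>p. p \<in> square T \<Longrightarrow> pd1 T (\<lambda>p. f p - g p) p = pd1 T f p - pd1 T g p"
    and pd2_diff: "\<And>p. p \<in> square T \<Longrightarrow> pd2 T (\<lambda>p. f p - g p) p = pd2 T f p - pd2 T g p"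
proof -
  note d = has_vector_derivative_diff[OF has_partials_has_vector_derivative(1)[OF assms(2)]
      has_partials_has_vector_derivative(1)[OF assms(3)]]
    has_vector_derivative_diff[OF has_partials_has_vector_derivative(2)[OF assms(2)]
      has_partials_has_vector_derivative(2)[OF assms(3)]]
  show "has_partials T (\<lambda>p. f p - g p)"
    by (rule has_partialsI[OF assms(1), of _ "\<lambda>p. pd1 T f p - pd1 T g p" "\<lambda>p. pd2 T f p - pd2 T g p"])
      (intro d; assumption)+
  show "pd1 T (\<lambda>p. f p - g p) p = pd1 T f p - pd1 T g p"
    "pd2 T (\<lambda>p. f p - g p) p = pd2 T f p - pd2 T g p"
    if "p \<in> square T" for p
    by (rule pd1_eqI[OF assms(1), of _ "\<lambda>p. pd1 T f p - pd1 T g p" "\<lambda>p. pd2 T f p - pd2 T g p"]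
        pd2_eqI[OF assms(1), of _ "\<lambda>p. pd1 T f p - pd1 T g p" "\<lambda>p. pd2 T f p - pd2 T g p"];
        (rule that | (rule d, assumption+)))+
qed

text \<open>The rules for \<open>pd1\<close> and \<open>pd2\<close> of images and differences are
  equalities on the square only, so the inductions over \<open>k\<close> below transfer regularity
  through this lemma.\<close>

lemma Ck_square_cong:
  fixes f g :: "real \<times> real \<Rightarrow> 'b::real_normed_vector"
  assumes "T > 0" and "Ck_square k T f" and "\<And>p. p \<in> square T \<Longrightarrow> g p = f p"
  shows "Ck_square k T g"
  using assms(2,3)
proof (induction k arbitrary: f g)
  case 0
  then show ?case by (simp cong: continuous_on_cong)
next
  case (Suc k)
  then have "has_partials T f" by simp
  note c = has_partials_cong[OF \<open>T > 0\<close> this Suc.prems(2)] pd1_cong[OF \<open>T > 0\<close> this Suc.prems(2)]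
    pd2_cong[OF \<open>T > 0\<close> this Suc.prems(2)]
  have "Ck_square k T (pd1 T g)" "Ck_square k T (pd2 T g)"
    using Suc.prems(1) by (auto intro: Suc.IH[OF _ c(2)] Suc.IH[OF _ c(3)])
  moreover have "continuous_on (square T) g"
    using Suc.prems by (simp cong: continuous_on_cong)
  ultimately show ?case using c(1) by simp
qed

lemma Ck_square_bounded_linear:
  fixes f :: "real \<times> real \<Rightarrow> 'b::real_normed_vector"
  assumes "T > 0" and "Ck_square k T f" and "bounded_linear h"
  shows "Ck_square k T (\<lambda>p. h (f p))"
  using assms(2)
proof (induction k arbitrary: f)
  case 0
  then show ?case using assms(3) by (simp add: bounded_linear.continuous_on)
next
  case (Suc k)
  then have "has_partials T f" by simp
  note c = has_partials_bounded_linear[OF \<open>T > 0\<close> this assms(3)]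
    pd1_bounded_linear[OF \<open>T > 0\<close> this assms(3)] pd2_bounded_linear[OF \<open>T > 0\<close> this assms(3)]
  have "Ck_square k T (pd1 T (\<lambda>p. h (f p)))" "Ck_square k T (pd2 T (\<lambda>p. h (f p)))"
    using Suc.prems(1) Suc.IH[of "pd1 T f"] Suc.IH[of "pd2 T f"]
    by (auto intro: Ck_square_cong[OF assms(1) _ c(2)] Ck_square_cong[OF assms(1) _ c(3)])
  moreover have "continuous_on (square T) (\<lambda>p. h (f p))"
    using Suc.prems assms(3) by (simp add: bounded_linear.continuous_on)
  ultimately show ?case using c(1) by simp
qed

lemma Ck_square_diff:
  fixes f g :: "real \<times> real \<Rightarrow> 'b::real_normed_vector"
  assumes "T > 0" and "Ck_square k T f" and "Ck_square k T g"
  shows "Ck_square k T (\<lambda>p. f p - g p)"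
  using assms(2,3)
proof (induction k arbitrary: f g)
  case 0
  then show ?case by (simp add: continuous_on_diff)
next
  case (Suc k)
  then have "has_partials T f" "has_partials T g" by simp_all
  note c = has_partials_diff[OF \<open>T > 0\<close> this] pd1_diff[OF \<open>T > 0\<close> this] pd2_diff[OF \<open>T > 0\<close> this]
  have "Ck_square k T (pd1 T (\<lambda>p. f p - g p))" "Ck_square k T (pd2 T (\<lambda>p. f p - g p))"
    using Suc.prems Suc.IH[of "pd1 T f" "pd1 T g"] Suc.IH[of "pd2 T f" "pd2 T g"]
    by (auto intro: Ck_square_cong[OF assms(1) _ c(2)] Ck_square_cong[OF assms(1) _ c(3)])
  moreover have "continuous_on (square T) (\<lambda>p. f p - g p)"
    using Suc.prems by (simp add: continuous_on_diff)
  ultimately show ?case using c(1) by simp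
qed

lemma pd_iterated_bounded_linear:
  fixes f :: "real \<times> real \<Rightarrow> 'b::real_normed_vector"
  assumes "T > 0" and "C2 T f" and "bounded_linear h" and "p \<in> square T"
  shows "pd1 T (pd1 T (\<lambda>p. h (f p))) p = h (pd1 T (pd1 T f) p)"
    and "pd1 T (pd2 T (\<lambda>p. h (f p))) p = h (pd1 T (pd2 T f) p)"
    and "pd2 T (pd2 T (\<lambda>p. h (f p))) p = h (pd2 T (pd2 T f) p)"
proof -
  have f: "has_partials T f" "has_partials T (pd1 T f)" "has_partials T (pd2 T f)"
    using assms(2) by (simp_all add: numeral_2_eq_2)
  note bl = has_partials_bounded_linear[OF assms(1) _ assms(3)]
    pd1_bounded_linear[OF assms(1) _ assms(3)] pd2_bounded_linear[OF assms(1) _ assms(3)]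
  show "pd1 T (pd1 T (\<lambda>p. h (f p))) p = h (pd1 T (pd1 T f) p)"
    \<comment> \<open>The inner derivative is first replaced by its value on the square, then the
      first-order rule is applied to \<open>pd1 T f\<close> itself. The other two cases follow the
      same pattern.\<close>
    using pd1_cong[OF assms(1) bl(1)[OF f(2)] bl(2)[OF f(1)] assms(4)] bl(2)[OF f(2) assms(4)] by simp
  show "pd1 T (pd2 T (\<lambda>p. h (f p))) p = h (pd1 T (pd2 T f) p)"
    using pd1_cong[OF assms(1) bl(1)[OF f(3)] bl(3)[OF f(1)] assms(4)] bl(2)[OF f(3) assms(4)] by simp
  show "pd2 T (pd2 T (\<lambda>p. h (f p))) p = h (pd2 T (pd2 T f) p)"
    using pd2_cong[OF assms(1) bl(1)[OF f(3)] bl(3)[OF f(1)] assms(4)] bl(3)[OF f(3) assms(4)] by simp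
qed

lemma pd_iterated_diff:
  fixes f g :: "real \<times> real \<Rightarrow> 'b::real_normed_vector"
  assumes "T > 0" and "C2 T f" and "C2 T g" and "p \<in> square T"
  shows "pd1 T (pd1 T (\<lambda>p. f p - g p)) p = pd1 T (pd1 T f) p - pd1 T (pd1 T g) p"
    and "pd1 T (pd2 T (\<lambda>p. f p - g p)) p = pd1 T (pd2 T f) p - pd1 T (pd2 T g) p"
    and "pd2 T (pd2 T (\<lambda>p. f p - g p)) p = pd2 T (pd2 T f) p - pd2 T (pd2 T g) p"
proof -
  have f: "has_partials T f" "has_partials T (pd1 T f)" "has_partials T (pd2 T f)"
    and g: "has_partials T g" "has_partials T (pd1 T g)" "has_partials T (pd2 T g)"
    using assms(2,3) by (simp_all add: numeral_2_eq_2)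
  note df = has_partials_diff[OF assms(1)] pd1_diff[OF assms(1)] pd2_diff[OF assms(1)]
  show "pd1 T (pd1 T (\<lambda>p. f p - g p)) p = pd1 T (pd1 T f) p - pd1 T (pd1 T g) p"
    using pd1_cong[OF assms(1) df(1)[OF f(2) g(2)] df(2)[OF f(1) g(1)] assms(4)]
      df(2)[OF f(2) g(2) assms(4)] by simp
  show "pd1 T (pd2 T (\<lambda>p. f p - g p)) p = pd1 T (pd2 T f) p - pd1 T (pd2 T g) p"
    using pd1_cong[OF assms(1) df(1)[OF f(3) g(3)] df(3)[OF f(1) g(1)] assms(4)]
      df(2)[OF f(3) g(3) assms(4)] by simp
  show "pd2 T (pd2 T (\<lambda>p. f p - g p)) p = pd2 T (pd2 T f) p - pd2 T (pd2 T g) p"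
    using pd2_cong[OF assms(1) df(1)[OF f(3) g(3)] df(3)[OF f(1) g(1)] assms(4)]
      df(3)[OF f(3) g(3) assms(4)] by simp
qed

section \<open>Sup norms and the \<open>C2\<close> norm\<close>

lemma norm_le_sup_norm:
  assumes "continuous_on (square T) f" and "p \<in> square T"
  shows "norm (f p) \<le> sup_norm T f"
  unfolding sup_norm_def
proof (rule cSUP_upper[OF assms(2)])
  have "compact (square T)"
    unfolding square_def by (intro compact_Times) auto
  \<comment> \<open>On the reals, \<open>SUP\<close> is a genuine upper bound only for sets bounded
    above; compactness of the square provides this.\<close>
  then show "bdd_above ((\<lambda>p. norm (f p)) ` square T)"
    using assms(1) by (intro bounded_imp_bdd_above compact_imp_bounded compact_continuous_image
        continuous_intros)
qed

lemma sup_norm_nonneg: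
  assumes "T > 0" and "continuous_on (square T) f"
  shows "sup_norm T f \<ge> 0"
  using norm_le_sup_norm[OF assms(2), of "(0, 0)"] assms(1)
  by (auto simp: square_def intro: order_trans[OF norm_ge_zero])

lemma sup_norm_le:
  assumes "T > 0" and "\<And>p. p \<in> square T \<Longrightarrow> norm (f p) \<le> b"
  shows "sup_norm T f \<le> b"
  unfolding sup_norm_def using assms by (intro cSUP_least) (auto simp: square_def)

lemma C2_continuous_on:
  assumes "C2 T f"
  shows "continuous_on (square T) f" "continuous_on (square T) (pd1 T f)"
    "continuous_on (square T) (pd2 T f)" "continuous_on (square T) (pd1 T (pd1 T f))"
    "continuous_on (square T) (pd1 T (pd2 T f))" "continuous_on (square T) (pd2 T (pd2 T f))"
  using assms by (simp_all add: numeral_2_eq_2)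

lemma C2_norm_nonneg:
  assumes "T > 0" and "C2 T f"
  shows "C2_norm T f \<ge> 0"
  unfolding C2_norm_def
  by (intro add_nonneg_nonneg sup_norm_nonneg[OF assms(1)] C2_continuous_on[OF assms(2)])

text \<open>The sup norm of this mixed derivative is one summand of \<open>C2_norm\<close>, and the
  other five are nonnegative.\<close>

lemma norm_pd12_le_C2_norm:
  assumes "T > 0" and "C2 T f" and "p \<in> square T"
  shows "norm (pd1 T (pd2 T f) p) \<le> C2_norm T f"
  using norm_le_sup_norm[OF C2_continuous_on(5)[OF assms(2)] assms(3)]
    C2_continuous_on[OF assms(2), THEN sup_norm_nonneg[OF assms(1)]]
  unfolding C2_norm_def by linarith

text \<open>Each partial derivative of the image is the image of the corresponding derivative, so
  the six summands can be compared one by one.\<close>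

lemma C2_norm_bounded_linear_le:
  assumes "T > 0" and "C2 T f" and "bounded_linear h" and h: "\<And>v. norm (h v) \<le> norm v"
  shows "C2_norm T (\<lambda>p. h (f p)) \<le> C2_norm T f"
proof -
  have 1: "has_partials T f"
    using assms(2) by (simp add: numeral_2_eq_2)
  show ?thesis
    unfolding C2_norm_def
    by (intro add_mono sup_norm_le[OF assms(1)])
      (simp_all add: pd_iterated_bounded_linear[OF assms(1-3)]
        pd1_bounded_linear[OF assms(1) 1 assms(3)] pd2_bounded_linear[OF assms(1) 1 assms(3)]
        order_trans[OF h norm_le_sup_norm] C2_continuous_on[OF assms(2)])
qed

text \<open>The separate name \<open>e\<close> is for derivatives of a difference, which equal the
  difference of the derivatives only on the square.\<close>

lemma sup_norm_triangle:
  assumes "T > 0" and "continuous_on (square T) e" "continuous_on (square T) g"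
    and "\<And>p. p \<in> square T \<Longrightarrow> e p = f p - g p"
  shows "sup_norm T f \<le> sup_norm T e + sup_norm T g"
proof (rule sup_norm_le[OF assms(1)])
  fix p assume p: "p \<in> square T"
  have "norm (f p) \<le> norm (e p) + norm (g p)"
    using norm_triangle_sub[of "f p" "g p"] by (simp add: assms(4) p)
  then show "norm (f p) \<le> sup_norm T e + sup_norm T g"
    using norm_le_sup_norm[OF assms(2) p] norm_le_sup_norm[OF assms(3) p] by linarith
qed

text \<open>In this form a bound on the distance to a centre \<open>g\<close> becomes a bound on the
  norm of \<open>f\<close>.\<close>

lemma C2_norm_triangle_sub:
  assumes "T > 0" and "C2 T f" and "C2 T g"
  shows "C2_norm T f \<le> C2_norm T (\<lambda>p. f p - g p) + C2_norm T g"
proof -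
  have 1: "has_partials T f" "has_partials T g"
    using assms(2,3) by (simp_all add: numeral_2_eq_2)
  \<comment> \<open>Facts 1 to 6 concern the difference and facts 7 to 12 concern \<open>g\<close>,
    both in the order of the summands of \<open>C2_norm\<close>.\<close>
  note cont = C2_continuous_on[OF Ck_square_diff[OF assms]] C2_continuous_on[OF assms(3)]
  note tri = sup_norm_triangle[OF assms(1) cont(1) cont(7)] sup_norm_triangle[OF assms(1) cont(2) cont(8)]
    sup_norm_triangle[OF assms(1) cont(3) cont(9)] sup_norm_triangle[OF assms(1) cont(4) cont(10)]
    sup_norm_triangle[OF assms(1) cont(5) cont(11)] sup_norm_triangle[OF assms(1) cont(6) cont(12)]
  show ?thesis
    using tri(1)[OF refl] tri(2)[OF pd1_diff[OF assms(1) 1]] tri(3)[OF pd2_diff[OF assms(1) 1]]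
      tri(4)[OF pd_iterated_diff(1)[OF assms]] tri(5)[OF pd_iterated_diff(2)[OF assms]]
      tri(6)[OF pd_iterated_diff(3)[OF assms]]
    unfolding C2_norm_def by linarith
qed

subsection \<open>Volume of the double simplex\<close>

text \<open>With \<open>A\<close> and \<open>B\<close> the products of the first \<open>n\<close>
  factors, the induction rests on
  \<open>A * a n - B * b n = (A - B) * b n + A * (a n - b n)\<close>.\<close>

lemma prod_diff_telescope:
  fixes a b :: "nat \<Rightarrow> 'a::comm_ring_1"
  shows "(\<Prod>i<n. a i) - (\<Prod>i<n. b i) =
    (\<Sum>k<n. (\<Prod>i<k. a i) * (\<Prod>j\<in>{k<..<n}. b j) * (a k - b k))"
proof (induction n)
  case (Suc n)
  \<comment> \<open>Only terms with \<open>k < n\<close> gain the factor \<open>b n\<close>; in the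
    new term \<open>k = n\<close> the product over \<open>b\<close> is empty.\<close>
  have "(\<Prod>j\<in>{k<..<Suc n}. b j) = (\<Prod>j\<in>{k<..<n}. b j) * b n" if "k < n" for k
  proof -
    have "{k<..<Suc n} = insert n {k<..<n}"
      using that by auto
    then show ?thesis by (simp add: mult.commute)
  qed
  then have "(\<Sum>k<Suc n. (\<Prod>i<k. a i) * (\<Prod>j\<in>{k<..<Suc n}. b j) * (a k - b k)) =
      (\<Sum>k<n. (\<Prod>i<k. a i) * (\<Prod>j\<in>{k<..<n}. b j) * (a k - b k)) * b n + (\<Prod>i<n. a i) * (a n - b n)"
    unfolding sum.lessThan_Suc sum_distrib_right
    by (intro arg_cong2[where f = "(+)"] sum.cong refl)
      (simp_all add: mult_ac flip: atLeastSucLessThan_greaterThanLessThan)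
  also have "\<dots> = (\<Prod>i<Suc n. a i) - (\<Prod>i<Suc n. b i)"
    unfolding Suc.IH[symmetric] by (simp add: algebra_simps)
  finally show ?case ..
qed simp

section \<open>Measurability of the double simplex\<close>

lemma sets_sorted_PiM:
  fixes \<phi> :: "'a \<Rightarrow> real"
  assumes [measurable]: "\<phi> \<in> borel_measurable M"
  shows "{r \<in> space (PiM {..<n} (\<lambda>_. M)). sorted (a # map (\<lambda>i. \<phi> (r i)) [0..<n] @ [b])}
    \<in> sets (PiM {..<n} (\<lambda>_. M))"
proof -
  \<comment> \<open>Each of the \<open>n + 2\<close> list entries is a constant endpoint or a
    function of one coordinate, so sortedness amounts to finitely many inequalities between
    measurable functions.\<close>
  have meas: "(\<lambda>r. (a # map (\<lambda>i. \<phi> (r i)) [0..<n] @ [b]) ! k) \<in> borel_measurable (PiM {..<n} (\<lambda>_. M))"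
    if "k < n + 2" for k
  proof (cases k)
    case (Suc j)
    then show ?thesis
      using that by (cases "j < n") (auto simp: nth_append)
  qed simp
  have "{r \<in> space (PiM {..<n} (\<lambda>_. M)). \<forall>k\<in>{..<n + 1}.
      (a # map (\<lambda>i. \<phi> (r i)) [0..<n] @ [b]) ! k \<le> (a # map (\<lambda>i. \<phi> (r i)) [0..<n] @ [b]) ! Suc k}
    \<in> sets (PiM {..<n} (\<lambda>_. M))"
    by (intro sets.sets_Collect_finite_All borel_measurable_le meas) simp_all
  moreover have "sorted (a # map (\<lambda>i. \<phi> (r i)) [0..<n] @ [b]) \<longleftrightarrow> (\<forall>k\<in>{..<n + 1}.
      (a # map (\<lambda>i. \<phi> (r i)) [0..<n] @ [b]) ! k \<le> (a # map (\<lambda>i. \<phi> (r i)) [0..<n] @ [b]) ! Suc k)"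
    for r
    unfolding sorted_iff_nth_Suc by auto
  ultimately show ?thesis
    by (simp only:)
qed

lemma sets_simplex2 [measurable]: "simplex2 n s t \<in> sets (PiM {..<n} (\<lambda>_. lborel))"
proof -
  have "simplex2 n s t =
    {r \<in> space (PiM {..<n} (\<lambda>_. lborel)). sorted (fst s # map (\<lambda>i. fst (r i)) [0..<n] @ [fst t])} \<inter>
    {r \<in> space (PiM {..<n} (\<lambda>_. lborel)). sorted (snd s # map (\<lambda>i. snd (r i)) [0..<n] @ [snd t])}"
    by (auto simp: simplex2_def space_PiM)
  moreover have "fst \<in> borel_measurable (lborel :: (real \<times> real) measure)"
    "snd \<in> borel_measurable (lborel :: (real \<times> real) measure)"
    by (simp_all flip: borel_prod)
  ultimately show ?thesis
    by (simp only: sets_sorted_PiM sets.Int)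
qed

text \<open>The function \<open>(x - a) ^ Suc n / fact (Suc n)\<close> is an antiderivative of the
  integrand and vanishes at \<open>a\<close>.\<close>

lemma nn_integral_power_Icc:
  fixes a b :: real
  assumes "a \<le> b"
  shows "(\<integral>\<^sup>+x. ennreal ((x - a) ^ n / fact n) * indicator {a..b} x \<partial>lborel) =
    ennreal ((b - a) ^ Suc n / fact (Suc n))"
proof -
  have "(\<integral>\<^sup>+x. ennreal ((x - a) ^ n / fact n) * indicator {a..b} x \<partial>lborel) =
    ennreal ((b - a) ^ Suc n / fact (Suc n) - (a - a) ^ Suc n / fact (Suc n))"
    by (rule nn_integral_FTC_Icc)
      (use assms in \<open>auto intro!: derivative_eq_intros simp: divide_simps simp del: power_Suc\<close>)
  then show ?thesis by simp
qed

text \<open>Tonelli, with Lebesgue measure on the plane read as a product measure.\<close>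

lemma nn_integral_lborel_prod_mult:
  fixes f g :: "real \<Rightarrow> ennreal"
  assumes [measurable]: "f \<in> borel_measurable borel" "g \<in> borel_measurable borel"
  shows "(\<integral>\<^sup>+y. f (fst y) * g (snd y) \<partial>lborel) = (\<integral>\<^sup>+x. f x \<partial>lborel) * (\<integral>\<^sup>+x. g x \<partial>lborel)"
proof -
  have "(\<integral>\<^sup>+y. f (fst y) * g (snd y) \<partial>lborel) = (\<integral>\<^sup>+y. f (fst y) * g (snd y) \<partial>(lborel \<Otimes>\<^sub>M lborel))"
    by (simp add: lborel_prod)
  also have "\<dots> = (\<integral>\<^sup>+x. \<integral>\<^sup>+y. f x * g y \<partial>lborel \<partial>lborel)"
    by (subst lborel.nn_integral_fst[symmetric]) auto
  also have "\<dots> = (\<integral>\<^sup>+x. f x \<partial>lborel) * (\<integral>\<^sup>+x. g x \<partial>lborel)"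
    by (simp add: nn_integral_cmult nn_integral_multc)
  finally show ?thesis .
qed

lemma sorted_append_last_two:
  "sorted (a # map f [0..<Suc n] @ [b]) \<longleftrightarrow> sorted (a # map f [0..<n] @ [f n]) \<and> f n \<le> b"
  for a b :: "'a::linorder"
  by (auto simp: sorted_append)

text \<open>Once the last point is fixed at \<open>y\<close>, it serves as the upper corner for the
  remaining \<open>n\<close> points. This is the recursion behind the volume formula.\<close>

lemma simplex2_upd:
  assumes "r \<in> {..<n} \<rightarrow>\<^sub>E UNIV"
  shows "r(n := y) \<in> simplex2 (Suc n) s t \<longleftrightarrow>
    r \<in> simplex2 n s y \<and> fst y \<le> fst t \<and> snd y \<le> snd t"
proof -
  have upd: "map (\<lambda>i. f ((r(n := y)) i)) [0..<n] = map (\<lambda>i. f (r i)) [0..<n]"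
    for f :: "real \<times> real \<Rightarrow> real"
    by simp
  have "r(n := y) \<in> {..<Suc n} \<rightarrow>\<^sub>E UNIV"
    using assms by (auto simp: PiE_def extensional_def)
  then show ?thesis
    using assms unfolding simplex2_def mem_Collect_eq sorted_append_last_two upd by auto
qed

text \<open>The endpoints belong to the sorted lists, so this holds even for \<open>n = 0\<close>.
  In the recursion it disposes of last points \<open>y\<close> that do not dominate
  \<open>s\<close>.\<close>

lemma simplex2_empty:
  assumes "\<not> (fst s \<le> fst t \<and> snd s \<le> snd t)"
  shows "simplex2 n s t = {}"
  using assms by (auto simp: simplex2_def)

lemma emeasure_simplex2:
  assumes "fst s \<le> fst t" and "snd s \<le> snd t"
  shows "emeasure (PiM {..<n} (\<lambda>_. lborel)) (simplex2 n s t) =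
    ennreal ((fst t - fst s) ^ n / fact n) * ennreal ((snd t - snd s) ^ n / fact n)"
  \<comment> \<open>The corner \<open>t\<close> is generalised because the induction hypothesis is
    used at the last point \<open>y\<close>.\<close>
  using assms
proof (induction n arbitrary: t)
  case 0
  \<comment> \<open>The empty product space has a single point, of mass 1.\<close>
  then have "simplex2 0 s t = {\<lambda>_. undefined}"
    by (auto simp: simplex2_def)
  then show ?case by (simp add: PiM_empty)
next
  case (Suc n)
  interpret product_sigma_finite "\<lambda>_::nat. lborel :: (real \<times> real) measure" ..
  let ?P = "PiM {..<n} (\<lambda>_. lborel :: (real \<times> real) measure)"
  let ?f = "\<lambda>x. ennreal ((x - fst s) ^ n / fact n) * indicator {fst s..fst t} x"
  let ?g = "\<lambda>x. ennreal ((x - snd s) ^ n / fact n) * indicator {snd s..snd t} x"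
  \<comment> \<open>The slice volume factors over the two axes. The indicators cover both the upper
    bound from \<open>t\<close> and the empty slices below \<open>s\<close>.\<close>
  have inner: "(\<integral>\<^sup>+ x. indicator (simplex2 (Suc n) s t) (x(n := y)) \<partial>?P) = ?f (fst y) * ?g (snd y)" for y
  proof -
    let ?c = "indicator {y. fst y \<le> fst t \<and> snd y \<le> snd t} y"
    have "(\<integral>\<^sup>+ x. indicator (simplex2 (Suc n) s t) (x(n := y)) \<partial>?P) =
      (\<integral>\<^sup>+ x. ?c * indicator (simplex2 n s y) x \<partial>?P)"
      by (rule nn_integral_cong) (auto simp: space_PiM simplex2_upd indicator_def)
    also have "\<dots> = ?c * emeasure ?P (simplex2 n s y)"
      by (simp add: nn_integral_cmult)
    also have "\<dots> = ?f (fst y) * ?g (snd y)"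
      using Suc.IH[of y] by (auto simp: simplex2_empty indicator_def)
    finally show ?thesis .
  qed
  have "emeasure (PiM {..<Suc n} (\<lambda>_. lborel)) (simplex2 (Suc n) s t) =
    (\<integral>\<^sup>+ x. indicator (simplex2 (Suc n) s t) x \<partial>PiM (insert n {..<n}) (\<lambda>_. lborel))"
    by (simp add: nn_integral_indicator flip: lessThan_Suc)
  also have "\<dots> = (\<integral>\<^sup>+ y. ?f (fst y) * ?g (snd y) \<partial>lborel)"
    \<comment> \<open>The reversed form puts the last point in the outer integral, leaving the
      slices computed in \<open>inner\<close> inside.\<close>
    by (subst product_nn_integral_insert_rev) (simp_all add: inner flip: lessThan_Suc)
  also have "\<dots> = (\<integral>\<^sup>+x. ?f x \<partial>lborel) * (\<integral>\<^sup>+x. ?g x \<partial>lborel)"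
    by (rule nn_integral_lborel_prod_mult) auto
  finally show ?case
    using Suc.prems by (simp only: nn_integral_power_Icc)
qed

lemma measure_simplex2:
  assumes "fst s \<le> fst t" and "snd s \<le> snd t"
  shows "measure (PiM {..<n} (\<lambda>_. lborel)) (simplex2 n s t) =
    ((fst t - fst s) * (snd t - snd s)) ^ n / (fact n)\<^sup>2"
  using assms
  by (simp add: measure_def emeasure_simplex2 power_mult_distrib power2_eq_square flip: ennreal_mult')

lemma simplex2_bounds:
  assumes "r \<in> simplex2 n s t" and "i < n"
  shows "fst s \<le> fst (r i)" "fst (r i) \<le> fst t" "snd s \<le> snd (r i)" "snd (r i) \<le> snd t"
  using assms by (auto simp: simplex2_def sorted_append)

subsection \<open>Estimates for the signature\<close>

text \<open>The permutation pairs the first coordinate of one point with the second of another; the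
  two chains of inequalities bound them separately.\<close>

lemma simplex2_in_square:
  assumes "s \<in> square T" and "t \<in> square T" and "r \<in> simplex2 n s t" and "i < n" and "j < n"
  shows "(fst (r i), snd (r j)) \<in> square T"
  using simplex2_bounds[OF assms(3,4)] simplex2_bounds[OF assms(3,5)] assms(1,2)
  by (auto simp: square_def)

lemma emeasure_simplex2_finite: "emeasure (PiM {..<n} (\<lambda>_. lborel)) (simplex2 n s t) < \<infinity>"
proof (cases "fst s \<le> fst t \<and> snd s \<le> snd t")
  case True
  then show ?thesis by (simp add: emeasure_simplex2 ennreal_mult_less_top)
qed (simp add: simplex2_empty)

text \<open>A bounded measurable function on a set of finite measure is integrable.\<close>

lemma set_integrable_simplex2_prod:
  fixes f :: "nat \<Rightarrow> real \<times> real \<Rightarrow> real"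
  assumes \<tau>: "\<tau> permutes {..<n}" and st: "s \<in> square T" "t \<in> square T"
    and f: "\<And>i. i < n \<Longrightarrow> continuous_on (square T) (f i)"
  shows "set_integrable (PiM {..<n} (\<lambda>_. lborel)) (simplex2 n s t)
    (\<lambda>r. \<Prod>i<n. f i (fst (r i), snd (r (\<tau> i))))"
proof -
  let ?M = "PiM {..<n} (\<lambda>_. lborel :: (real \<times> real) measure)"
  have \<tau>n: "\<tau> i < n" if "i < n" for i
    using permutes_in_image[OF \<tau>, of i] that by simp
  \<comment> \<open>Continuity is known on the square only; extension by zero from this closed set
    gives a Borel function on the whole plane.\<close>
  define g where "g i p = indicator (square T) p *\<^sub>R f i p" for i p
  have "closed (square T)"
    unfolding square_def by (intro closed_Times) auto
  then have [measurable]: "g i \<in> borel_measurable borel" if "i < n" for i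
    unfolding g_def by (intro borel_measurable_continuous_on_indicator f that) auto
  have [measurable]: "fst \<in> borel_measurable (lborel :: (real \<times> real) measure)"
    "snd \<in> borel_measurable (lborel :: (real \<times> real) measure)"
    by (simp_all flip: borel_prod)
  have "(\<lambda>r. g i (fst (r i), snd (r (\<tau> i)))) \<in> borel_measurable ?M" if "i < n" for i
  proof -
    have [measurable]: "(\<lambda>r. r i) \<in> measurable ?M lborel" "(\<lambda>r. r (\<tau> i)) \<in> measurable ?M lborel"
      using that \<tau>n by auto
    have "(\<lambda>r. (fst (r i), snd (r (\<tau> i)))) \<in> borel_measurable ?M"
      by measurable
    from measurable_compose[OF this] show ?thesis
      using that by measurable
  qed
  then have meas: "(\<lambda>r. \<Prod>i<n. g i (fst (r i), snd (r (\<tau> i)))) \<in> borel_measurable ?M"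
    by (intro borel_measurable_prod) auto
  have "\<bar>\<Prod>i<n. g i (fst (r i), snd (r (\<tau> i)))\<bar> \<le> (\<Prod>i<n. sup_norm T (f i))"
    if "r \<in> simplex2 n s t" for r
    unfolding abs_prod g_def
    using norm_le_sup_norm[OF f] simplex2_in_square[OF st that] \<tau>n
    by (intro prod_mono) auto
  then have "set_integrable ?M (simplex2 n s t) (\<lambda>r. \<Prod>i<n. g i (fst (r i), snd (r (\<tau> i))))"
    unfolding set_integrable_def
    by (intro integrableI_bounded_set_indicator meas sets_simplex2 emeasure_simplex2_finite) auto
  \<comment> \<open>On the simplex every argument lies in the square, where \<open>g\<close> and
    \<open>f\<close> agree.\<close>
  moreover have "set_integrable ?M (simplex2 n s t) (\<lambda>r. \<Prod>i<n. g i (fst (r i), snd (r (\<tau> i)))) \<longleftrightarrow>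
    set_integrable ?M (simplex2 n s t) (\<lambda>r. \<Prod>i<n. f i (fst (r i), snd (r (\<tau> i))))"
    using simplex2_in_square[OF st] \<tau>n by (intro set_integrable_cong) (auto simp: g_def)
  ultimately show ?thesis by simp
qed

lemma abs_set_lebesgue_integral_le:
  fixes f :: "'a \<Rightarrow> real"
  assumes "set_integrable M A f" and A: "A \<in> sets M" "emeasure M A < \<infinity>"
    and "\<And>x. x \<in> A \<Longrightarrow> \<bar>f x\<bar> \<le> B"
  shows "\<bar>LINT x:A|M. f x\<bar> \<le> B * measure M A"
proof -
  have "\<bar>LINT x:A|M. f x\<bar> \<le> (LINT x|M. \<bar>indicator A x *\<^sub>R f x\<bar>)"
    unfolding set_lebesgue_integral_def by (rule integral_abs_bound)
  also have "\<dots> \<le> (LINT x|M. B * indicator A x)"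
  proof (rule integral_mono)
    show "integrable M (\<lambda>x. \<bar>indicator A x *\<^sub>R f x\<bar>)"
      using assms(1) by (simp add: set_integrable_def)
    show "integrable M (\<lambda>x. B * indicator A x)"
      using A by simp
  qed (use assms(4) in \<open>auto simp: indicator_def\<close>)
  also have "\<dots> = B * measure M A"
    using A by simp
  finally show ?thesis .
qed

lemma
  fixes f :: "real \<times> real \<Rightarrow> real^'d"
  assumes "T > 0" and "C2 T f"
  shows C2_component: "C2 T (\<lambda>p. f p $ k)"
    and C2_norm_component_le: "C2_norm T (\<lambda>p. f p $ k) \<le> C2_norm T f"
  using Ck_square_bounded_linear[OF assms bounded_linear_vec_nth]
    C2_norm_bounded_linear_le[OF assms bounded_linear_vec_nth, of k] component_le_norm_cart
  by auto

lemma full_signature_diff_le: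
  fixes X Y :: "real \<times> real \<Rightarrow> real^'d"
  assumes T: "T > 0" and X: "C2 T X" and Y: "C2 T Y"
    and \<tau>: "\<tau> permutes {..<length w}"
    and st: "s \<in> square T" "t \<in> square T" "fst s \<le> fst t" "snd s \<le> snd t"
  shows "\<bar>full_signature T s t X (w, \<tau>) - full_signature T s t Y (w, \<tau>)\<bar>
      \<le> T ^ (2 * length w) / (fact (length w))\<^sup>2 *
        (\<Sum>k<length w.
          ((\<Prod>i<k. C2_norm T (\<lambda>p. X p $ (w ! i))) *
           (\<Prod>j\<in>{k<..<length w}. C2_norm T (\<lambda>p. Y p $ (w ! j)))) *
          C2_norm T (\<lambda>p. X p $ (w ! k) - Y p $ (w ! k)))"
    (is "_ \<le> _ * ?B")
proof -
  let ?n = "length w"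
  let ?M = "PiM {..<?n} (\<lambda>_. lborel :: (real \<times> real) measure)"
  let ?S = "simplex2 ?n s t"
  define f where "f i = pd1 T (pd2 T (\<lambda>p. X p $ (w ! i)))" for i
  define g where "g i = pd1 T (pd2 T (\<lambda>p. Y p $ (w ! i)))" for i
  have C2: "C2 T (\<lambda>p. X p $ k)" "C2 T (\<lambda>p. Y p $ k)" for k
    by (intro C2_component T X Y)+
  then have C2d: "C2 T (\<lambda>p. X p $ k - Y p $ k)" for k
    using Ck_square_diff T by blast
  have f: "\<bar>f i p\<bar> \<le> C2_norm T (\<lambda>p. X p $ (w ! i))"
    and g: "\<bar>g i p\<bar> \<le> C2_norm T (\<lambda>p. Y p $ (w ! i))"
    and fg: "\<bar>f i p - g i p\<bar> \<le> C2_norm T (\<lambda>p. X p $ (w ! i) - Y p $ (w ! i))"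
    if "p \<in> square T" for i p
    using norm_pd12_le_C2_norm[OF T C2(1) that] norm_pd12_le_C2_norm[OF T C2(2) that]
      norm_pd12_le_C2_norm[OF T C2d that]
    by (simp_all add: f_def g_def pd_iterated_diff(2)[OF T C2 that])
  \<comment> \<open>Integrability of both products justifies merging the two signatures into one
    integral.\<close>
  have int: "set_integrable ?M ?S (\<lambda>r. \<Prod>i<?n. f i (fst (r i), snd (r (\<tau> i))))"
    "set_integrable ?M ?S (\<lambda>r. \<Prod>i<?n. g i (fst (r i), snd (r (\<tau> i))))"
    using C2_continuous_on(5)[OF C2(1)] C2_continuous_on(5)[OF C2(2)]
    by (auto intro!: set_integrable_simplex2_prod[OF \<tau> st(1,2)] simp: f_def g_def)
  have "\<bar>full_signature T s t X (w, \<tau>) - full_signature T s t Y (w, \<tau>)\<bar> =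
    \<bar>LINT r:?S|?M. (\<Prod>i<?n. f i (fst (r i), snd (r (\<tau> i)))) - (\<Prod>i<?n. g i (fst (r i), snd (r (\<tau> i))))\<bar>"
    unfolding set_integral_diff(2)[OF int] by (simp add: full_signature_def f_def g_def)
  also have "\<dots> \<le> ?B * measure ?M ?S"
  proof (rule abs_set_lebesgue_integral_le[OF set_integral_diff(1)[OF int]
        sets_simplex2 emeasure_simplex2_finite])
    fix r assume r: "r \<in> ?S"
    have p: "(fst (r i), snd (r (\<tau> i))) \<in> square T" if "i < ?n" for i
      using simplex2_in_square[OF st(1,2) r that] permutes_in_image[OF \<tau>, of i] that by simp
    \<comment> \<open>The telescoped sum is bounded term by term: \<open>f\<close> before position
      \<open>k\<close>, \<open>g\<close> after it, and the mixed derivative of the difference at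
      \<open>k\<close>.\<close>
    show "\<bar>(\<Prod>i<?n. f i (fst (r i), snd (r (\<tau> i)))) - (\<Prod>i<?n. g i (fst (r i), snd (r (\<tau> i))))\<bar> \<le> ?B"
      unfolding prod_diff_telescope
      by (rule order_trans[OF sum_abs])
        (auto simp: abs_mult abs_prod prod_nonneg C2_norm_nonneg[OF T] C2 C2d
          intro!: sum_mono mult_mono prod_mono mult_nonneg_nonneg f g fg p)
  qed
  also have "\<dots> \<le> ?B * (T ^ (2 * ?n) / (fact ?n)\<^sup>2)"
  proof (rule mult_left_mono)
    \<comment> \<open>Both side lengths of the rectangle are at most \<open>T\<close>.\<close>
    have "((fst t - fst s) * (snd t - snd s)) ^ ?n \<le> (T * T) ^ ?n"
      using st by (intro power_mono mult_mono mult_nonneg_nonneg) (auto simp: square_def)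
    also have "\<dots> = T ^ (2 * ?n)"
      by (simp add: power_mult power2_eq_square)
    finally show "measure ?M ?S \<le> T ^ (2 * ?n) / (fact ?n)\<^sup>2"
      unfolding measure_simplex2[OF st(3,4)] by (intro divide_right_mono) auto
    show "0 \<le> ?B"
      by (intro sum_nonneg mult_nonneg_nonneg prod_nonneg C2_norm_nonneg[OF T] C2 C2d ballI)
  qed
  finally show ?thesis
    by (simp only: mult.commute)
qed

section \<open>Local Lipschitz continuity of each coordinate\<close>

lemma C2_locally_lipschitz_full_signature:
  assumes T: "T > 0" and \<tau>: "\<tau> permutes {..<length w}"
    and st: "s \<in> square T" "t \<in> square T" "fst s \<le> fst t" "snd s \<le> snd t"
  shows "C2_locally_lipschitz T (\<lambda>Z :: real \<times> real \<Rightarrow> real^'d. full_signature T s t Z (w, \<tau>))"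
  unfolding C2_locally_lipschitz_def
proof (intro allI impI)
  fix X0 :: "real \<times> real \<Rightarrow> real^'d"
  assume X0: "C2 T X0"
  let ?n = "length w"
  \<comment> \<open>By the triangle inequality \<open>M\<close> bounds the norm on the unit ball
    around \<open>X0\<close>. The summand 1 also gives \<open>M \<ge> 1\<close>, so that powers of
    \<open>M\<close> grow with the exponent.\<close>
  define M where "M = C2_norm T X0 + 1"
  \<comment> \<open>There are \<open>?n\<close> terms, and each of the two products in a term is at
    most \<open>M ^ ?n\<close>.\<close>
  define L where "L = T ^ (2 * ?n) / (fact ?n)\<^sup>2 * (of_nat ?n * (M ^ ?n * M ^ ?n))"
  have "M \<ge> 1"
    using C2_norm_nonneg[OF T X0] by (simp add: M_def)
  have prod_le: "(\<Prod>i\<in>I. C2_norm T (\<lambda>p. Z p $ (w ! i))) \<le> M ^ ?n"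
    if Z: "C2 T Z" "C2_norm T (\<lambda>p. Z p - X0 p) < 1" and I: "I \<subseteq> {..<?n}"
    for Z :: "real \<times> real \<Rightarrow> real^'d" and I
  proof -
    have "C2_norm T Z \<le> M"
      using C2_norm_triangle_sub[OF T Z(1) X0] Z(2) by (simp add: M_def)
    then have "(\<Prod>i\<in>I. C2_norm T (\<lambda>p. Z p $ (w ! i))) \<le> (\<Prod>i\<in>I. M)"
      using C2_component[OF T Z(1)] C2_norm_component_le[OF T Z(1)] C2_norm_nonneg[OF T]
      by (intro prod_mono) (auto intro: order_trans)
    \<comment> \<open>At most \<open>?n\<close> factors occur; padding with further factors
      \<open>M \<ge> 1\<close> makes the bound uniform in \<open>I\<close>.\<close>
    also have "\<dots> \<le> M ^ ?n"
      using \<open>M \<ge> 1\<close> card_mono[OF _ I] by (auto intro: power_increasing)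
    finally show ?thesis .
  qed
  show "\<exists>\<epsilon>>0. \<exists>L\<ge>0. \<forall>X Y. C2 T X \<longrightarrow> C2 T Y \<longrightarrow> C2_norm T (\<lambda>p. X p - X0 p) < \<epsilon> \<longrightarrow>
    C2_norm T (\<lambda>p. Y p - X0 p) < \<epsilon> \<longrightarrow>
    \<bar>full_signature T s t X (w, \<tau>) - full_signature T s t Y (w, \<tau>)\<bar> \<le> L * C2_norm T (\<lambda>p. X p - Y p)"
  proof (rule exI[of _ 1], intro conjI exI[of _ L] allI impI)
    show "L \<ge> 0"
      using \<open>M \<ge> 1\<close> T unfolding L_def by simp
    fix X Y :: "real \<times> real \<Rightarrow> real^'d"
    assume X: "C2 T X" "C2_norm T (\<lambda>p. X p - X0 p) < 1"
      and Y: "C2 T Y" "C2_norm T (\<lambda>p. Y p - X0 p) < 1"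
    note XY = Ck_square_diff[OF T X(1) Y(1)]
    have XYk: "C2 T (\<lambda>p. X p $ k - Y p $ k)"
      "C2_norm T (\<lambda>p. X p $ k - Y p $ k) \<le> C2_norm T (\<lambda>p. X p - Y p)" for k
      using C2_component[OF T XY, of k] C2_norm_component_le[OF T XY, of k] by simp_all
    have "(\<Sum>k<?n. ((\<Prod>i<k. C2_norm T (\<lambda>p. X p $ (w ! i))) *
           (\<Prod>j\<in>{k<..<?n}. C2_norm T (\<lambda>p. Y p $ (w ! j)))) *
          C2_norm T (\<lambda>p. X p $ (w ! k) - Y p $ (w ! k))) \<le>
        (\<Sum>k<?n. (M ^ ?n * M ^ ?n) * C2_norm T (\<lambda>p. X p - Y p))"
    proof (rule sum_mono)
      fix k assume "k \<in> {..<?n}"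
      then have "(\<Prod>i<k. C2_norm T (\<lambda>p. X p $ (w ! i))) \<le> M ^ ?n"
        "(\<Prod>j\<in>{k<..<?n}. C2_norm T (\<lambda>p. Y p $ (w ! j))) \<le> M ^ ?n"
        by (auto intro!: prod_le X Y)
      then show "((\<Prod>i<k. C2_norm T (\<lambda>p. X p $ (w ! i))) *
           (\<Prod>j\<in>{k<..<?n}. C2_norm T (\<lambda>p. Y p $ (w ! j)))) *
          C2_norm T (\<lambda>p. X p $ (w ! k) - Y p $ (w ! k)) \<le>
        (M ^ ?n * M ^ ?n) * C2_norm T (\<lambda>p. X p - Y p)"
        using \<open>M \<ge> 1\<close>
        by (intro mult_mono XYk)
          (simp_all add: prod_nonneg C2_norm_nonneg[OF T] C2_component[OF T] X Y XYk)
    qed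
    then have "T ^ (2 * ?n) / (fact ?n)\<^sup>2 * (\<Sum>k<?n. ((\<Prod>i<k. C2_norm T (\<lambda>p. X p $ (w ! i))) *
           (\<Prod>j\<in>{k<..<?n}. C2_norm T (\<lambda>p. Y p $ (w ! j)))) *
          C2_norm T (\<lambda>p. X p $ (w ! k) - Y p $ (w ! k))) \<le>
        T ^ (2 * ?n) / (fact ?n)\<^sup>2 * (\<Sum>k<?n. (M ^ ?n * M ^ ?n) * C2_norm T (\<lambda>p. X p - Y p))"
      using T by (intro mult_left_mono) auto
    also have "\<dots> = L * C2_norm T (\<lambda>p. X p - Y p)"
      unfolding L_def sum_constant card_lessThan by (simp only: mult.assoc)
    finally show "\<bar>full_signature T s t X (w, \<tau>) - full_signature T s t Y (w, \<tau>)\<bar> \<le> L * C2_norm T (\<lambda>p. X p - Y p)"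
      by (rule order_trans[OF full_signature_diff_le[OF T X(1) Y(1) \<tau> st]])
  qed simp
qed

theorem proposition4p27:
  fixes T :: real
    and X X' :: "real \<times> real \<Rightarrow> real^'d"
    and w :: "'d list"
    and \<tau> :: "nat \<Rightarrow> nat"
    and s t :: "real \<times> real"
  assumes "T > 0"
    and "C2 T X" and "C2 T X'"
    and "\<tau> permutes {..<length w}"
    and "s \<in> square T" and "t \<in> square T"
    and "fst s \<le> fst t" and "snd s \<le> snd t"
  shows "\<bar>full_signature T s t X (w, \<tau>) - full_signature T s t X' (w, \<tau>)\<bar>
      \<le> T ^ (2 * length w) / (fact (length w))\<^sup>2 *
        (\<Sum>k<length w.
          ((\<Prod>i<k. C2_norm T (\<lambda>p. X p $ (w ! i))) *
           (\<Prod>j\<in>{k<..<length w}. C2_norm T (\<lambda>p. X' p $ (w ! j)))) *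
          C2_norm T (\<lambda>p. X p $ (w ! k) - X' p $ (w ! k)))
    \<and> C2_locally_lipschitz T (\<lambda>Z :: real \<times> real \<Rightarrow> real^'d. full_signature T s t Z (w, \<tau>))"
  using assms by (intro conjI full_signature_diff_le C2_locally_lipschitz_full_signature)

end
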